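(* Let $G$ and $H$ be finite simple graphs that are not complete. Then $$A_b(G\vee H)=\max\{A_b(G)+n_H,\;A_b(H)+n_G\}.$$ Moreover, for any finite simple graph $G$ and any $q\geq 1$, $A_b(G\vee K_q)=A_b(G)+q$.
   Context: $n_G$ is the number of vertices of $G$. The join $G\vee H$ is obtained from disjoint copies of $G$ and $H$ by adding all edges between $V(G)$ and $V(H)$. A (proper) $k$-coloring of $G$ is a map $c:V(G)\to[k]$ with adjacent vertices colored differently, all $k$ colors used; $V_i=c^{-1}(i)$. A coloring is acyclic if $G[V_i\cup V_j]$ is a forest for all $i,j$. A vertex $v$ is a b-vertex if the colors on $v$ and its neighbors are all $k$ colors. A recoloring step applied to $c$ and a color $i$ having no b-vertex recolors every $v\in V_i$ with a color not appearing on $v$ or its neighbors, producing a $(k-1)$-coloring; if both colorings are acyclic it is an acyclic recoloring step. The acyclic b-chromatic number $A_b(G)$ is the maximum number of colors of an acyclic coloring of $G$ to which no acyclic recoloring step can be applied. *)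

theory Defs
  imports "Graph_Theory.Graph_Theory"
begin

text \<open>
  Finite simple graphs are the library's \<open>pair_graph\<close>s: an undirected edge is a pair of opposite
  arcs. Consequently the library's \<open>forest\<close> (no directed cycle at all) is not the undirected notion,
  since each edge already yields a directed cycle of length 2; an undirected cycle is a directed
  cycle of length at least 3.
\<close>

definition undirected_forest :: "('a, 'b) pre_digraph \<Rightarrow> bool" where
  "undirected_forest D \<longleftrightarrow> \<not> (\<exists>p. pre_digraph.cycle D p \<and> 3 \<le> length p)"

definition join_graph ::
  "'a pair_pre_digraph \<Rightarrow> 'b pair_pre_digraph \<Rightarrow> ('a + 'b) pair_pre_digraph" (infixl \<open>\<or>\<^sub>G\<close> 65) where
  "G \<or>\<^sub>G H = \<lparr> pverts = pverts G <+> pverts H,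
     parcs = {(Inl u, Inl v) |u v. (u, v) \<in> parcs G} \<union> {(Inr u, Inr v) |u v. (u, v) \<in> parcs H}
       \<union> {(Inl u, Inr v) |u v. u \<in> pverts G \<and> v \<in> pverts H}
       \<union> {(Inr v, Inl u) |u v. u \<in> pverts G \<and> v \<in> pverts H} \<rparr>"

text \<open>
  Colorings carry their set \<open>C\<close> of colors, all of which must be used; a \<open>k\<close>-coloring is the case
  \<open>C = {1..k}\<close>. This way a recoloring step that removes the color \<open>i\<close> yields a coloring with the
  \<open>k - 1\<close> colors \<open>C - {i}\<close> without renaming colors.
\<close>

definition proper_coloring :: "'a pair_pre_digraph \<Rightarrow> nat set \<Rightarrow> ('a \<Rightarrow> nat) \<Rightarrow> bool" where
  "proper_coloring G C c \<longleftrightarrow> c ` pverts G = C \<and> (\<forall>(u, v) \<in> parcs G. c u \<noteq> c v)"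

definition color_class :: "'a pair_pre_digraph \<Rightarrow> ('a \<Rightarrow> nat) \<Rightarrow> nat \<Rightarrow> 'a set" where
  "color_class G c i = {v \<in> pverts G. c v = i}"

definition acyclic_coloring :: "'a pair_pre_digraph \<Rightarrow> nat set \<Rightarrow> ('a \<Rightarrow> nat) \<Rightarrow> bool" where
  "acyclic_coloring G C c \<longleftrightarrow> proper_coloring G C c \<and>
     (\<forall>i\<in>C. \<forall>j\<in>C. undirected_forest (with_proj G \<restriction> (color_class G c i \<union> color_class G c j)))"

definition closed_nbhd :: "'a pair_pre_digraph \<Rightarrow> 'a \<Rightarrow> 'a set" where
  "closed_nbhd G v = insert v {w. (v, w) \<in> parcs G}"

definition b_vertex :: "'a pair_pre_digraph \<Rightarrow> nat set \<Rightarrow> ('a \<Rightarrow> nat) \<Rightarrow> 'a \<Rightarrow> bool" where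
  "b_vertex G C c v \<longleftrightarrow> v \<in> pverts G \<and> c ` closed_nbhd G v = C"

definition recoloring_step ::
  "'a pair_pre_digraph \<Rightarrow> nat set \<Rightarrow> ('a \<Rightarrow> nat) \<Rightarrow> nat \<Rightarrow> ('a \<Rightarrow> nat) \<Rightarrow> bool" where
  "recoloring_step G C c i c' \<longleftrightarrow> proper_coloring G C c \<and> i \<in> C \<and>
     (\<forall>v \<in> color_class G c i. \<not> b_vertex G C c v) \<and>
     (\<forall>v \<in> color_class G c i. c' v \<in> C - c ` closed_nbhd G v) \<and>
     (\<forall>v \<in> pverts G - color_class G c i. c' v = c v)"

definition acyclic_recoloring_step ::
  "'a pair_pre_digraph \<Rightarrow> nat set \<Rightarrow> ('a \<Rightarrow> nat) \<Rightarrow> nat \<Rightarrow> ('a \<Rightarrow> nat) \<Rightarrow> bool" where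
  "acyclic_recoloring_step G C c i c' \<longleftrightarrow> recoloring_step G C c i c' \<and>
     acyclic_coloring G C c \<and> acyclic_coloring G (C - {i}) c'"

definition acyclic_b_spectrum :: "'a pair_pre_digraph \<Rightarrow> nat set" where
  "acyclic_b_spectrum G = {k. \<exists>c. acyclic_coloring G {1..k} c \<and>
     \<not> (\<exists>i c'. acyclic_recoloring_step G {1..k} c i c')}"

definition acyclic_b_chromatic :: "'a pair_pre_digraph \<Rightarrow> nat" (\<open>A\<^sub>b\<close>) where
  "acyclic_b_chromatic G = Max (acyclic_b_spectrum G)"

lemma pair_graph_join:
  assumes "pair_graph G" "pair_graph H"
  shows "pair_graph (G \<or>\<^sub>G H)"
proof -
  interpret G: pair_graph G by fact
  interpret H: pair_graph H by fact
  let ?J = "G \<or>\<^sub>G H"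
  have sub: "parcs ?J \<subseteq> pverts ?J \<times> pverts ?J"
    by (auto simp: join_graph_def dest: G.wellformed' H.wellformed')
  have fin: "finite (pverts ?J)"
    by (simp add: join_graph_def)
  show ?thesis
  proof
    show "finite (parcs ?J)" using sub fin by (meson finite_SigmaI finite_subset)
    show "symmetric (with_proj ?J)"
      using G.sym_arcs H.sym_arcs
      by (auto simp: symmetric_def join_graph_def intro!: symI dest: symD)
    show "fst e \<noteq> snd e" if "e \<in> parcs ?J" for e
      using that by (auto simp: join_graph_def dest: G.no_loops' H.no_loops')
  qed (use sub fin in auto)
qed

lemma proper_coloring_recoloring_step:
  assumes "pair_graph G" "recoloring_step G C c i c'"
  shows "proper_coloring G (C - {i}) c'"
proof -
  interpret pair_graph G by fact
  have sym: "(v, u) \<in> parcs G" if "(u, v) \<in> parcs G" for u v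
    using sym_arcs that by (auto simp: symmetric_def dest: symD)
  have c: "c ` pverts G = C" "\<And>u v. (u, v) \<in> parcs G \<Longrightarrow> c u \<noteq> c v"
    and new: "\<And>v. v \<in> pverts G \<Longrightarrow> c v = i \<Longrightarrow> c' v \<in> C - c ` closed_nbhd G v"
    and old: "\<And>v. v \<in> pverts G \<Longrightarrow> c v \<noteq> i \<Longrightarrow> c' v = c v"
    using assms(2) by (auto simp: recoloring_step_def proper_coloring_def color_class_def)
  have "c' v \<in> C - {i}" if "v \<in> pverts G" for v
    using new[OF that] old[OF that] c(1) that by (cases "c v = i") (auto simp: closed_nbhd_def)
  moreover have "j \<in> c' ` pverts G" if "j \<in> C - {i}" for j
    using that c(1) old by force
  moreover have "c' u \<noteq> c' v" if uv: "(u, v) \<in> parcs G" for u v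
  proof -
    have "u \<in> pverts G" "v \<in> pverts G" using uv by (auto dest: wellformed')
    moreover have "c v \<in> c ` closed_nbhd G u" "c u \<in> c ` closed_nbhd G v"
      using uv sym[OF uv] by (auto simp: closed_nbhd_def)
    ultimately show ?thesis
      using c(2)[OF uv] new[of u] new[of v] old[of u] old[of v]
      by (cases "c u = i"; cases "c v = i") auto
  qed
  ultimately show ?thesis by (auto simp: proper_coloring_def)
qed

lemma acyclic_coloring_comp:
  assumes "pair_wf_digraph G" "acyclic_coloring G C c" "inj_on f C"
  shows "acyclic_coloring G (f ` C) (f \<circ> c)"
proof -
  have im: "c ` pverts G = C" and proper: "\<forall>(u, v) \<in> parcs G. c u \<noteq> c v"
    using assms(2) by (auto simp: acyclic_coloring_def proper_coloring_def)
  have wf: "u \<in> pverts G" "v \<in> pverts G" if "(u, v) \<in> parcs G" for u v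
    using pair_wf_digraph.in_arcsD1[OF assms(1) that] pair_wf_digraph.in_arcsD2[OF assms(1) that]
    by auto
  have cls: "color_class G (f \<circ> c) (f i) = color_class G c i" if "i \<in> C" for i
    using that im assms(3) by (auto simp: color_class_def inj_on_def)
  have "f (c u) \<noteq> f (c v)" if uv: "(u, v) \<in> parcs G" for u v
    using proper uv inj_on_eq_iff[OF assms(3), of "c u" "c v"] im wf[OF uv] by auto
  moreover have "(f \<circ> c) ` pverts G = f ` C" by (simp only: im image_comp[symmetric])
  ultimately show ?thesis
    using assms(2) by (auto simp: acyclic_coloring_def proper_coloring_def cls)
qed

lemma undirected_forest_small:
  assumes "wf_digraph D" "finite (verts D)" "card (verts D) \<le> 2"
  shows "undirected_forest D"
  unfolding undirected_forest_def
proof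
  interpret wf_digraph D by fact
  assume "\<exists>p. pre_digraph.cycle D p \<and> 3 \<le> length p"
  then obtain u p where p: "awalk u p u" "distinct (tl (awalk_verts u p))" "3 \<le> length p"
    by (auto simp: cycle_def)
  have "set (tl (awalk_verts u p)) \<subseteq> verts D"
    using p(1) by (cases "awalk_verts u p") (auto simp: awalk_conv)
  then have "length (tl (awalk_verts u p)) \<le> card (verts D)"
    by (simp only: distinct_card[OF p(2), symmetric] card_mono[OF assms(2)])
  then show False using p(3) assms(3) by (simp add: length_awalk_verts)
qed

lemma finite_acyclic_b_spectrum:
  assumes "finite (pverts G)"
  shows "finite (acyclic_b_spectrum G)"
proof (rule finite_subset)
  show "acyclic_b_spectrum G \<subseteq> {..card (pverts G)}"
  proof
    fix k assume "k \<in> acyclic_b_spectrum G"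
    then obtain c where "c ` pverts G = {1..k}"
      by (auto simp: acyclic_b_spectrum_def acyclic_coloring_def proper_coloring_def)
    then show "k \<in> {..card (pverts G)}"
      using card_image_le[OF assms, of c] by simp
  qed
qed simp

lemma acyclic_b_spectrum_nonempty:
  assumes "pair_graph G"
  shows "acyclic_b_spectrum G \<noteq> {}"
proof -
  interpret pair_graph G by fact
  let ?P = "\<lambda>k. \<exists>c. acyclic_coloring G {1..k} c"
  obtain c where c: "bij_betw c (pverts G) {1..card (pverts G)}"
    using finite_same_card_bij[OF pair_finite_verts, of "{1..card (pverts G)}"] by auto
  have cls: "finite (color_class G c i) \<and> card (color_class G c i) \<le> 1" for i
    using c by (auto simp: color_class_def bij_betw_def inj_on_def card_le_Suc0_iff_eq)
  have "undirected_forest (with_proj G \<restriction> (color_class G c i \<union> color_class G c j))" for i j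
  proof (rule undirected_forest_small)
    show "card (verts (with_proj G \<restriction> (color_class G c i \<union> color_class G c j))) \<le> 2"
      using card_Un_le[of "color_class G c i" "color_class G c j"] cls[of i] cls[of j] by simp
  qed (use cls in auto)
  moreover have "proper_coloring G {1..card (pverts G)} c"
    unfolding proper_coloring_def
  proof (intro conjI ballI, goal_cases)
    case 1
    then show ?case using c by (simp add: bij_betw_def)
  next
    case (2 e)
    then obtain u v where e: "e = (u, v)" "(u, v) \<in> parcs G" by (cases e) auto
    then show ?case
      using c wellformed'[OF e(2)] no_loops'[OF e(2)] by (auto simp: bij_betw_def inj_on_def)
  qed
  ultimately have "?P (card (pverts G))" by (auto simp: acyclic_coloring_def)
  then have "?P (LEAST k. ?P k)" by (rule LeastI)
  then obtain k c where k_def: "k = (LEAST k. ?P k)" and k: "acyclic_coloring G {1..k} c" by auto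
  have min: "\<not> ?P m" if "m < k" for m
    using not_less_Least[of m ?P] that unfolding k_def by blast
  have "\<not> acyclic_recoloring_step G {1..k} c i c'" for i c'
  proof
    assume "acyclic_recoloring_step G {1..k} c i c'"
    then have i: "i \<in> {1..k}" and ac: "acyclic_coloring G ({1..k} - {i}) c'"
      by (auto simp: acyclic_recoloring_step_def recoloring_step_def)
    have "card ({1..k} - {i}) = card {1..k - 1}" using i by simp
    then obtain f where "bij_betw f ({1..k} - {i}) {1..k - 1}"
      using finite_same_card_bij[of "{1..k} - {i}" "{1..k - 1}"] by auto
    then have "acyclic_coloring G {1..k - 1} (f \<circ> c')"
      using acyclic_coloring_comp[OF pair_wf_digraph_axioms ac, of f] by (simp add: bij_betw_def)
    then have "?P (k - 1)" by blast
    with min[of "k - 1"] i show False by simp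
  qed
  with k show ?thesis by (auto simp: acyclic_b_spectrum_def)
qed

end

theory Submission
  imports Defs
begin

text \<open>
  In a proper coloring of a join the two sides use disjoint sets of colors. If both sides repeated a
  color, the two classes would span a 4-cycle; so an acyclic coloring is injective on one side,
  say \<open>H\<close>, and conversely any acyclic coloring of \<open>G\<close> extended injectively to \<open>H\<close> is acyclic,
  since classes on opposite sides then span stars. Acyclic recoloring steps removing a color of
  \<open>G\<close> are exactly those of \<open>G\<close>, while a step removing a color of \<open>H\<close> repeats a color on \<open>H\<close> and is
  therefore only possible if \<open>G\<close> is colored injectively as well. An injective coloring of a
  non-complete graph always admits a step (merge two non-adjacent vertices), so the unreducible
  colorings of the join are exactly those unreducible on one side and injective on the other.
\<close>

section \<open>Undirected cycles of an induced subgraph as lists of vertices\<close>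

lemma successively_pcas:
  assumes "pcas u p v" "set p \<subseteq> A"
  shows "successively (\<lambda>x y. (x, y) \<in> A) (u # map snd p)" "last (u # map snd p) = v"
  using assms by (induction p arbitrary: u) (auto split: if_splits)

lemma pcas_vwalk_arcs: "pcas u (vwalk_arcs (u # vs)) (last (u # vs))"
  by (induction vs arbitrary: u) auto

lemma map_snd_vwalk_arcs: "map snd (vwalk_arcs (u # vs)) = vs"
  by (induction vs arbitrary: u) auto

lemma set_vwalk_arcs_subset_iff:
  "set (vwalk_arcs (u # vs)) \<subseteq> A \<longleftrightarrow> successively (\<lambda>x y. (x, y) \<in> A) (u # vs)"
  by (induction vs arbitrary: u) auto

text \<open>\<open>cas\<close> consults only the end points of arcs, which restriction to
  \<open>S\<close> leaves alone; so facts about \<open>pcas\<close> apply to induced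
  subgraphs.\<close>

lemma cas_induce_with_proj:
  "pre_digraph.cas (with_proj G \<restriction> S) = pcas"
proof (intro ext)
  show "pre_digraph.cas (with_proj G \<restriction> S) u p v = pcas u p v" for u p v
    by (induction p arbitrary: u) (auto simp: pre_digraph.cas.simps)
qed

lemma successively_in_induced:
  assumes "successively (\<lambda>x y. (x, y) \<in> A) xs" "set xs \<subseteq> S"
  shows "successively (\<lambda>x y. (x, y) \<in> {e \<in> A. fst e \<in> S \<and> snd e \<in> S}) xs"
  using assms by (induction xs rule: induct_list012) auto

text \<open>A cycle is determined by the list \<open>vs\<close> of the heads of its arcs. Prepending
  \<open>last vs\<close> lets \<open>successively\<close> cover the closing edge too, so concrete
  cycles can be checked without handling arcs.\<close>

lemma undirected_forest_induce_iff:
  "undirected_forest (with_proj G \<restriction> S) \<longleftrightarrow>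
     \<not> (\<exists>vs. 3 \<le> length vs \<and> distinct vs \<and> set vs \<subseteq> S \<and>
            successively (\<lambda>x y. (x, y) \<in> parcs G) (last vs # vs))"
proof -
  let ?D = "with_proj G \<restriction> S" and ?A = "{e \<in> parcs G. fst e \<in> S \<and> snd e \<in> S}"
  have "(\<exists>p. pre_digraph.cycle ?D p \<and> 3 \<le> length p) \<longleftrightarrow>
    (\<exists>vs. 3 \<le> length vs \<and> distinct vs \<and> set vs \<subseteq> S \<and>
            successively (\<lambda>x y. (x, y) \<in> parcs G) (last vs # vs))" (is "?L = ?R")
  proof
    assume ?L
    then obtain p u where p: "pcas u p u" "set p \<subseteq> ?A" "3 \<le> length p" and
      d: "distinct (tl (pre_digraph.awalk_verts ?D u p))"
      by (auto simp: pre_digraph.cycle_def pre_digraph.awalk_def cas_induce_with_proj)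
    \<comment> \<open>Since \<open>p\<close> is non-empty, dropping the start vertex leaves
      \<open>map snd p\<close>, which is the list that \<open>cycle\<close> requires to be
      distinct.\<close>
    have "pre_digraph.awalk_verts ?D u p = fst (hd p) # map snd p"
      using pre_digraph.awalk_verts_conv'[of ?D u p u] p by (auto simp: cas_induce_with_proj)
    then have "distinct (map snd p)" using d by simp
    moreover have "set (map snd p) \<subseteq> S" using p(2) by auto
    moreover have "last (map snd p) = u"
      using successively_pcas(2)[OF p(1,2)] p(3) by (cases p) auto
    moreover have "successively (\<lambda>x y. (x, y) \<in> parcs G) (u # map snd p)"
      using p(2) by (intro successively_pcas(1)[OF p(1)]) auto
    ultimately show ?R using p(3) by (intro exI[of _ "map snd p"]) simp
  next
    assume ?R
    then obtain vs where vs: "3 \<le> length vs" "distinct vs" "set vs \<subseteq> S"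
      "successively (\<lambda>x y. (x, y) \<in> parcs G) (last vs # vs)" by blast
    \<comment> \<open>Starting at the last vertex of \<open>vs\<close> closes the walk while keeping
      \<open>vs\<close> as its list of heads.\<close>
    define u where "u = last vs"
    define p where "p = vwalk_arcs (u # vs)"
    have u: "last (u # vs) = u" "u \<in> S"
      using vs(1,3) last_in_set[of vs] by (fastforce simp: u_def)+
    have "pcas u p u" using pcas_vwalk_arcs[of u vs] u by (simp add: p_def)
    moreover have "set p \<subseteq> ?A"
      unfolding p_def set_vwalk_arcs_subset_iff
      using vs(3,4) u(2) by (intro successively_in_induced) (auto simp: u_def)
    moreover have mp: "map snd p = vs" by (simp add: p_def map_snd_vwalk_arcs)
    moreover have "length p = length vs" using mp by (metis length_map)
    moreover have "pre_digraph.awalk_verts ?D u p = fst (hd p) # map snd p"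
      using pre_digraph.awalk_verts_conv'[of ?D u p u] vs(1) calculation
      by (auto simp: cas_induce_with_proj)
    ultimately have "pre_digraph.cycle ?D p \<and> 3 \<le> length p"
      using vs(1,2) u by (auto simp: pre_digraph.cycle_def pre_digraph.awalk_def cas_induce_with_proj)
    then show ?L by blast
  qed
  then show ?thesis by (simp add: undirected_forest_def)
qed

section \<open>Criteria for acyclicity\<close>

text \<open>All edges inside \<open>S\<close> meet \<open>w\<close>, but a cycle of length at least
  3 has an edge avoiding any given vertex.\<close>

lemma undirected_forest_star:
  assumes "\<And>u v. (u, v) \<in> parcs G \<Longrightarrow> u \<in> S \<Longrightarrow> v \<in> S \<Longrightarrow> u = w \<or> v = w"
  shows "undirected_forest (with_proj G \<restriction> S)"
  unfolding undirected_forest_induce_iff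
proof safe
  fix vs assume vs: "3 \<le> length vs" "distinct vs" "set vs \<subseteq> S"
    "successively (\<lambda>x y. (x, y) \<in> parcs G) (last vs # vs)"
  from vs(1) obtain a b c r where abc: "vs = a # b # c # r"
    by (auto simp: numeral_3_eq_3 Suc_le_length_iff)
  have "a = w \<or> b = w" "b = w \<or> c = w" using assms[of a b] assms[of b c] vs abc by auto
  \<comment> \<open>\<open>a\<close> and \<open>c\<close> are distinct, so they cannot both be
    \<open>w\<close>. The edge leaving \<open>c\<close>, to \<open>a\<close> or to a fourth vertex
    \<open>d\<close>, then misses \<open>w\<close>.\<close>
  then have "b = w" using vs(2) abc by auto
  show False
  proof (cases r)
    case Nil
    then show False using assms[of c a] vs abc \<open>b = w\<close> by auto
  next
    case (Cons d s)
    then show False using assms[of c d] vs abc \<open>b = w\<close> by auto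
  qed
qed

text \<open>As \<open>c\<close> is constant on a color class, injectivity there says that the class
  has at most one vertex. Edges join different colors, so that vertex is the center of a
  star.\<close>

lemma undirected_forest_singleton_class:
  assumes "proper_coloring G C c" "inj_on c (color_class G c i)"
  shows "undirected_forest (with_proj G \<restriction> (color_class G c i \<union> color_class G c j))"
proof -
  obtain w where w: "\<And>v. v \<in> color_class G c i \<Longrightarrow> v = w"
    using assms(2) unfolding inj_on_def color_class_def by (metis (mono_tags, lifting) mem_Collect_eq)
  show ?thesis
  proof (rule undirected_forest_star)
    fix u v assume "(u, v) \<in> parcs G" and uv: "u \<in> color_class G c i \<union> color_class G c j"
      "v \<in> color_class G c i \<union> color_class G c j"
    then have "c u \<noteq> c v" using assms(1) by (auto simp: proper_coloring_def)
    then show "u = w \<or> v = w" using uv w by (auto simp: color_class_def)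
  qed
qed

text \<open>Only \<open>i0\<close> may be repeated, so two different classes always include one with
  at most one vertex. This covers injective colorings and those obtained from them by merging two
  vertices.\<close>

lemma acyclic_coloring_inj_except:
  assumes "proper_coloring G C c" "inj_on c {v \<in> pverts G. c v \<noteq> i0}"
  shows "acyclic_coloring G C c"
  unfolding acyclic_coloring_def
proof (intro conjI ballI)
  have inj: "inj_on c (color_class G c i)" if "i \<noteq> i0" for i
    using assms(2) that by (auto simp: inj_on_def color_class_def)
  show "undirected_forest (with_proj G \<restriction> (color_class G c i \<union> color_class G c j))" for i j
  proof (cases "i = i0")
    case False
    then show ?thesis using undirected_forest_singleton_class[OF assms(1)] inj by blast
  next
    case True
    show ?thesis
    proof (cases "j = i0")
      case False
      then show ?thesis using undirected_forest_singleton_class[OF assms(1), of j i] inj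
        by (simp add: Un_commute)
    next
      case j: True
      \<comment> \<open>A single class spans no edge, so the star criterion holds vacuously for any
        center.\<close>
      show ?thesis
        using assms(1) True j
        by (intro undirected_forest_star) (auto simp: proper_coloring_def color_class_def)
    qed
  qed
qed (rule assms(1))

section \<open>Recoloring steps and renaming of colors\<close>

lemma closed_nbhd_subset:
  assumes "pair_wf_digraph G" "v \<in> pverts G"
  shows "closed_nbhd G v \<subseteq> pverts G"
  using assms pair_wf_digraph.in_arcsD2 by (fastforce simp: closed_nbhd_def)

lemma image_closed_nbhd_subset:
  assumes "pair_wf_digraph G" "proper_coloring G C c" "v \<in> pverts G"
  shows "c ` closed_nbhd G v \<subseteq> C"
  using closed_nbhd_subset[OF assms(1,3)] assms(2) by (auto simp: proper_coloring_def)

text \<open>A free color for every vertex of the class already excludes b-vertices.\<close>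
lemma recoloring_step_iff:
  "recoloring_step G C c i c' \<longleftrightarrow> proper_coloring G C c \<and> i \<in> C \<and>
     (\<forall>v \<in> pverts G. c v = i \<longrightarrow> c' v \<in> C - c ` closed_nbhd G v) \<and>
     (\<forall>v \<in> pverts G. c v \<noteq> i \<longrightarrow> c' v = c v)"
  unfolding recoloring_step_def color_class_def b_vertex_def by blast

text \<open>The colorings counted by \<open>acyclic_b_spectrum\<close>, but over an arbitrary color
  set: the colors that a coloring of a join uses on one side need not form an initial
  segment.\<close>

definition acyclic_b_coloring :: "'a pair_pre_digraph \<Rightarrow> nat set \<Rightarrow> ('a \<Rightarrow> nat) \<Rightarrow> bool" where
  "acyclic_b_coloring G C c \<longleftrightarrow>
     acyclic_coloring G C c \<and> \<not> (\<exists>i c'. acyclic_recoloring_step G C c i c')"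

lemma color_class_cong:
  assumes "\<And>v. v \<in> pverts G \<Longrightarrow> c v = d v"
  shows "color_class G c i = color_class G d i"
  using assms by (auto simp: color_class_def)

lemma acyclic_coloring_cong:
  assumes "pair_wf_digraph G" "\<And>v. v \<in> pverts G \<Longrightarrow> c v = d v"
  shows "acyclic_coloring G C c \<longleftrightarrow> acyclic_coloring G C d"
proof -
  have "c u = d u" "c v = d v" if "(u, v) \<in> parcs G" for u v
    using pair_wf_digraph.wellformed'[OF assms(1) that] assms(2) by auto
  then have "(\<forall>(u, v) \<in> parcs G. c u \<noteq> c v) \<longleftrightarrow> (\<forall>(u, v) \<in> parcs G. d u \<noteq> d v)"
    by auto
  moreover have "c ` pverts G = d ` pverts G" using assms(2) by (rule image_cong[OF refl])
  ultimately show ?thesis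
    using color_class_cong[of G c d] assms(2)
    by (simp add: acyclic_coloring_def proper_coloring_def)
qed

text \<open>Injective renaming preserves classes and free colors. \<open>d\<close> is constrained
  only on vertices because undoing a renaming recovers the original coloring only there.\<close>

lemma acyclic_recoloring_step_rename:
  assumes wf: "pair_wf_digraph G" and step: "acyclic_recoloring_step G C c i c'"
    and inj: "inj_on h C"
    and d: "\<And>v. v \<in> pverts G \<Longrightarrow> d v = h (c v)"
  shows "acyclic_recoloring_step G (h ` C) d (h i) (h \<circ> c')"
proof -
  have rs: "proper_coloring G C c" "i \<in> C"
    and new: "\<And>v. v \<in> pverts G \<Longrightarrow> c v = i \<Longrightarrow> c' v \<in> C - c ` closed_nbhd G v"
    and old: "\<And>v. v \<in> pverts G \<Longrightarrow> c v \<noteq> i \<Longrightarrow> c' v = c v"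
    and ac: "acyclic_coloring G C c" "acyclic_coloring G (C - {i}) c'"
    using step by (auto simp: acyclic_recoloring_step_def recoloring_step_iff)
  have V: "c v \<in> C" if "v \<in> pverts G" for v
    using rs(1) that by (auto simp: proper_coloring_def)
  have acd: "acyclic_coloring G (h ` C) d"
    using acyclic_coloring_comp[OF wf ac(1) inj] acyclic_coloring_cong[OF wf, of d "h \<circ> c"] d by simp
  have "h ` (C - {i}) = h ` C - {h i}"
    using inj rs(2) inj_on_image_set_diff[of h C C "{i}"] by auto
  then have acd': "acyclic_coloring G (h ` C - {h i}) (h \<circ> c')"
    using acyclic_coloring_comp[OF wf ac(2), of h] inj by (simp add: inj_on_diff)
  have "(h \<circ> c') v \<in> h ` C - d ` closed_nbhd G v" if v: "v \<in> pverts G" "d v = h i" for v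
  proof -
    have "c v = i" using v d inj V rs(2) by (auto simp: inj_on_def)
    then have c'v: "c' v \<in> C - c ` closed_nbhd G v" using new v by blast
    have "d ` closed_nbhd G v = h ` c ` closed_nbhd G v"
      using closed_nbhd_subset[OF wf v(1)] d by (force simp: image_image)
    moreover have "c ` closed_nbhd G v \<subseteq> C"
      using image_closed_nbhd_subset[OF wf rs(1) v(1)] .
    ultimately show ?thesis using c'v inj by (auto dest: inj_onD)
  qed
  moreover have "(h \<circ> c') v = d v" if v: "v \<in> pverts G" "d v \<noteq> h i" for v
    using d[OF v(1)] v(2) old[OF v(1)] by fastforce
  moreover have "proper_coloring G (h ` C) d" using acd by (simp add: acyclic_coloring_def)
  ultimately show ?thesis
    using rs(2) acd acd' by (simp add: acyclic_recoloring_step_def recoloring_step_iff)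
qed

text \<open>Rename the colors to \<open>{1..card C}\<close> by a bijection \<open>h\<close>; a step
  for the renamed coloring would pull back along the inverse \<open>g\<close> to a step for
  \<open>c\<close>.\<close>

lemma card_in_acyclic_b_spectrum:
  assumes "pair_graph G" "acyclic_b_coloring G C c"
  shows "card C \<in> acyclic_b_spectrum G"
proof -
  interpret pair_graph G by fact
  have C: "c ` pverts G = C" and ac: "acyclic_coloring G C c"
    using assms(2) by (auto simp: acyclic_b_coloring_def acyclic_coloring_def proper_coloring_def)
  then have "finite C" using pair_finite_verts by auto
  then obtain h where h: "bij_betw h C {1..card C}"
    using finite_same_card_bij[of C "{1..card C}"] by auto
  define g where "g = inv_into C h"
  have inj: "inj_on h C" "h ` C = {1..card C}" using h by (auto simp: bij_betw_def)
  have g: "inj_on g {1..card C}" "g ` {1..card C} = C"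
    using bij_betw_inv_into[OF h] by (auto simp: bij_betw_def g_def)
  have "\<not> acyclic_recoloring_step G {1..card C} (h \<circ> c) i c'" for i c'
  proof
    assume "acyclic_recoloring_step G {1..card C} (h \<circ> c) i c'"
    moreover have "c v = g ((h \<circ> c) v)" if "v \<in> pverts G" for v
      using that C inj by (auto simp: g_def)
    ultimately have "acyclic_recoloring_step G C c (g i) (g \<circ> c')"
      using acyclic_recoloring_step_rename[OF pair_wf_digraph_axioms _ g(1), of "h \<circ> c" i c' c] g(2)
      by simp
    then show False using assms(2) by (auto simp: acyclic_b_coloring_def)
  qed
  moreover have "acyclic_coloring G {1..card C} (h \<circ> c)"
    using acyclic_coloring_comp[OF pair_wf_digraph_axioms ac inj(1)] inj(2) by simp
  ultimately show ?thesis by (auto simp: acyclic_b_spectrum_def)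
qed

lemma acyclic_b_coloring_not_inj:
  assumes "pair_graph G" "\<not> complete_digraph (card (pverts G)) (with_proj G)"
    and "acyclic_b_coloring G C c"
  shows "\<not> inj_on c (pverts G)"
proof
  assume inj: "inj_on c (pverts G)"
  interpret pair_graph G by fact
  have "parcs G \<noteq> {(u, v). (u, v) \<in> pverts G \<times> pverts G \<and> u \<noteq> v}"
    using assms(2) pair_finite_verts by (simp add: complete_digraph_pair_def)
  then obtain u v where uv: "u \<in> pverts G" "v \<in> pverts G" "u \<noteq> v" "(u, v) \<notin> parcs G"
    using wellformed' no_loops' by fast
  have pc: "proper_coloring G C c" and ac: "acyclic_coloring G C c"
    using assms(3) by (auto simp: acyclic_b_coloring_def acyclic_coloring_def)
  have C: "c ` pverts G = C" using pc by (simp add: proper_coloring_def)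
  \<comment> \<open>By injectivity \<open>u\<close> is the whole class of \<open>c u\<close>, so
    moving \<open>u\<close> to the color of its non-neighbor \<open>v\<close> eliminates that
    color.\<close>
  let ?d = "c(u := c v)"
  have nb: "c v \<notin> c ` closed_nbhd G u"
  proof
    assume "c v \<in> c ` closed_nbhd G u"
    then obtain w where "w \<in> closed_nbhd G u" "c v = c w" by auto
    moreover have "w \<in> pverts G"
      using closed_nbhd_subset[OF pair_wf_digraph_axioms uv(1)] calculation by auto
    ultimately show False using inj uv by (auto simp: closed_nbhd_def dest: inj_onD)
  qed
  have rs: "recoloring_step G C c (c u) ?d"
    unfolding recoloring_step_iff
  proof (intro conjI ballI impI)
    show "?d w \<in> C - c ` closed_nbhd G w" if "w \<in> pverts G" "c w = c u" for w
      using inj_onD[OF inj that(2) that(1) uv(1)] nb uv(2) C by auto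
  qed (use pc C uv in auto)
  \<comment> \<open>\<open>c v\<close> is the only color that \<open>?d\<close> repeats.\<close>
  have "inj_on ?d {w \<in> pverts G. ?d w \<noteq> c v}" using inj by (auto simp: inj_on_def)
  then have "acyclic_coloring G (C - {c u}) ?d"
    using acyclic_coloring_inj_except proper_coloring_recoloring_step[OF assms(1) rs] by blast
  then have "acyclic_recoloring_step G C c (c u) ?d"
    using rs ac by (simp add: acyclic_recoloring_step_def)
  then show False using assms(3) by (auto simp: acyclic_b_coloring_def)
qed

text \<open>A join given by embeddings \<open>f\<close>, \<open>g\<close> of its two sides, so that the sides can be swapped.\<close>
locale graph_join =
  G: pair_graph G + H: pair_graph H + J: pair_graph J
  for G :: "'a pair_pre_digraph" and H :: "'b pair_pre_digraph" and J :: "'c pair_pre_digraph" +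
  fixes f :: "'a \<Rightarrow> 'c" and g :: "'b \<Rightarrow> 'c"
  assumes inj_f: "inj f" and inj_g: "inj g" and f_neq_g: "f x \<noteq> g y"
    and pverts_J: "pverts J = f ` pverts G \<union> g ` pverts H"
    and arc_ff: "(f x, f x') \<in> parcs J \<longleftrightarrow> (x, x') \<in> parcs G"
    and arc_gg: "(g y, g y') \<in> parcs J \<longleftrightarrow> (y, y') \<in> parcs H"
    and arc_fg: "(f x, g y) \<in> parcs J \<longleftrightarrow> x \<in> pverts G \<and> y \<in> pverts H"
    and arc_gf: "(g y, f x) \<in> parcs J \<longleftrightarrow> x \<in> pverts G \<and> y \<in> pverts H"
begin

section \<open>Colorings of a join and of its sides\<close>

lemma swap: "graph_join H G J g f"
  using inj_f inj_g pverts_J arc_ff arc_gg arc_fg arc_gf f_neq_g[symmetric]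
  by unfold_locales (simp_all add: Un_commute conj_commute)

text \<open>\<open>f\<close> is injective and both preserves and reflects arcs, so
  \<open>map f\<close> matches the cycles in \<open>S\<close> with those in its image.\<close>

lemma forest_image_iff:
  "undirected_forest (with_proj J \<restriction> (f ` S)) \<longleftrightarrow> undirected_forest (with_proj G \<restriction> S)"
proof -
  have eq: "successively (\<lambda>x y. (x, y) \<in> parcs J) (last (map f vs) # map f vs) \<longleftrightarrow>
      successively (\<lambda>x y. (x, y) \<in> parcs G) (last vs # vs)" if "vs \<noteq> []" for vs
    using successively_map[of "\<lambda>x y. (x, y) \<in> parcs J" f "last vs # vs"] that
    by (simp add: last_map arc_ff del: successively.simps)
  have dist: "distinct (map f vs) \<longleftrightarrow> distinct vs" for vs
    using inj_f by (auto simp: distinct_map inj_on_def)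
  have sub: "set (map f vs) \<subseteq> f ` S \<longleftrightarrow> set vs \<subseteq> S" for vs
    using inj_f by (simp add: inj_image_subset_iff)
  have "(\<exists>vs. 3 \<le> length vs \<and> distinct vs \<and> set vs \<subseteq> f ` S \<and>
            successively (\<lambda>x y. (x, y) \<in> parcs J) (last vs # vs)) \<longleftrightarrow>
        (\<exists>vs. 3 \<le> length vs \<and> distinct vs \<and> set vs \<subseteq> S \<and>
            successively (\<lambda>x y. (x, y) \<in> parcs G) (last vs # vs))" (is "?L = ?R")
  proof
    assume ?L
    then obtain vs where vs: "3 \<le> length vs" "distinct vs" "set vs \<subseteq> f ` S"
      "successively (\<lambda>x y. (x, y) \<in> parcs J) (last vs # vs)" by blast
    have "\<exists>ws. vs = map f ws" using vs(3) by (auto simp: ex_map_conv)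
    then obtain ws where ws: "vs = map f ws" ..
    then have "ws \<noteq> []" using vs(1) by auto
    then show ?R
      using vs dist[of ws] sub[of ws] eq[of ws] unfolding ws by (intro exI[of _ ws]) simp
  next
    assume ?R
    then obtain vs where vs: "3 \<le> length vs" "distinct vs" "set vs \<subseteq> S"
      "successively (\<lambda>x y. (x, y) \<in> parcs G) (last vs # vs)" by blast
    then have "vs \<noteq> []" by auto
    then show ?L
      using vs dist[of vs] sub[of vs] eq[of vs] by (intro exI[of _ "map f vs"]) simp
  qed
  then show ?thesis by (simp add: undirected_forest_induce_iff)
qed

lemma color_class_left:
  assumes "i \<notin> c ` g ` pverts H"
  shows "color_class J c i = f ` color_class G (c \<circ> f) i"
  using assms pverts_J by (auto simp: color_class_def)

lemma arc_cases:
  assumes "(a, b) \<in> parcs J"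
  obtains x x' where "a = f x" "b = f x'" "(x, x') \<in> parcs G"
  | y y' where "a = g y" "b = g y'" "(y, y') \<in> parcs H"
  | x y where "a = f x" "b = g y" "x \<in> pverts G" "y \<in> pverts H"
  | x y where "a = g y" "b = f x" "x \<in> pverts G" "y \<in> pverts H"
proof -
  have "a \<in> f ` pverts G \<union> g ` pverts H" "b \<in> f ` pverts G \<union> g ` pverts H"
    using J.wellformed'[OF assms] pverts_J by auto
  then show thesis using assms that by (auto simp: arc_ff arc_gg)
qed

text \<open>The edges between the sides say exactly that no color occurs on both of them.\<close>

lemma proper_coloring_join_iff:
  "proper_coloring J C c \<longleftrightarrow> C = c ` f ` pverts G \<union> c ` g ` pverts H \<and>
     c ` f ` pverts G \<inter> c ` g ` pverts H = {} \<and>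
     proper_coloring G (c ` f ` pverts G) (c \<circ> f) \<and> proper_coloring H (c ` g ` pverts H) (c \<circ> g)"
  (is "?L = ?R")
proof
  assume ?L
  then have C: "c ` (f ` pverts G \<union> g ` pverts H) = C"
    and e: "\<And>a b. (a, b) \<in> parcs J \<Longrightarrow> c a \<noteq> c b"
    by (auto simp: proper_coloring_def pverts_J)
  have "c (f x) \<noteq> c (g y)" if "x \<in> pverts G" "y \<in> pverts H" for x y
    using e[of "f x" "g y"] that arc_fg by simp
  moreover have "c (f x) \<noteq> c (f x')" if "(x, x') \<in> parcs G" for x x'
    using e[of "f x" "f x'"] that arc_ff by simp
  moreover have "c (g y) \<noteq> c (g y')" if "(y, y') \<in> parcs H" for y y'
    using e[of "g y" "g y'"] that arc_gg by simp
  ultimately show ?R using C by (auto simp: proper_coloring_def)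
next
  assume R: ?R
  have "c a \<noteq> c b" if "(a, b) \<in> parcs J" for a b
    using that by (cases rule: arc_cases) (use R in \<open>auto simp: proper_coloring_def\<close>)
  then show ?L using R by (auto simp: proper_coloring_def pverts_J)
qed

lemma acyclic_coloring_joinD_left:
  assumes "acyclic_coloring J C c"
  shows "acyclic_coloring G (c ` f ` pverts G) (c \<circ> f)"
proof -
  have pc: "proper_coloring J C c" using assms by (simp add: acyclic_coloring_def)
  note R = pc[unfolded proper_coloring_join_iff]
  have "undirected_forest (with_proj G \<restriction> (color_class G (c \<circ> f) i \<union> color_class G (c \<circ> f) j))"
    if ij: "i \<in> c ` f ` pverts G" "j \<in> c ` f ` pverts G" for i j
  proof -
    have "i \<notin> c ` g ` pverts H" "j \<notin> c ` g ` pverts H" "i \<in> C" "j \<in> C" using R ij by blast+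
    then have "undirected_forest (with_proj J \<restriction>
        (f ` color_class G (c \<circ> f) i \<union> f ` color_class G (c \<circ> f) j))"
      using assms color_class_left by (metis acyclic_coloring_def)
    then show ?thesis by (simp add: image_Un[symmetric] forest_image_iff)
  qed
  then show ?thesis using R by (simp add: acyclic_coloring_def)
qed

text \<open>Two repeated colors on opposite sides would span a 4-cycle.\<close>
lemma acyclic_coloring_join_inj:
  assumes "acyclic_coloring J C c"
  shows "inj_on (c \<circ> f) (pverts G) \<or> inj_on (c \<circ> g) (pverts H)"
proof (rule ccontr)
  assume "\<not> ?thesis"
  then obtain x x' y y' where x: "x \<in> pverts G" "x' \<in> pverts G" "x \<noteq> x'" "c (f x) = c (f x')"
    and y: "y \<in> pverts H" "y' \<in> pverts H" "y \<noteq> y'" "c (g y) = c (g y')"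
    by (auto simp: inj_on_def)
  let ?S = "color_class J c (c (f x)) \<union> color_class J c (c (g y))"
  have "c (f x) \<in> C" "c (g y) \<in> C"
    using assms x(1) y(1) by (auto simp: acyclic_coloring_def proper_coloring_def pverts_J)
  then have "undirected_forest (with_proj J \<restriction> ?S)" using assms by (simp add: acyclic_coloring_def)
  moreover have "set [f x, g y, f x', g y'] \<subseteq> ?S"
    using x y by (auto simp: color_class_def pverts_J)
  moreover have "distinct [f x, g y, f x', g y']"
    using x(3) y(3) inj_f inj_g f_neq_g f_neq_g[symmetric] by (auto dest: injD)
  moreover have "successively (\<lambda>a b. (a, b) \<in> parcs J)
      (last [f x, g y, f x', g y'] # [f x, g y, f x', g y'])"
    using x y by (simp add: arc_fg arc_gf)
  moreover have "3 \<le> length [f x, g y, f x', g y']" by simp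
  ultimately show False unfolding undirected_forest_induce_iff by blast
qed

text \<open>If one of two classes has a color from \<open>B\<close>, it has at most one vertex and
  the pair spans a star; otherwise both classes come from \<open>G\<close>.\<close>

lemma acyclic_coloring_joinI:
  assumes "acyclic_coloring G A (c \<circ> f)" "acyclic_coloring H B (c \<circ> g)"
    and "A \<inter> B = {}" "inj_on (c \<circ> g) (pverts H)"
  shows "acyclic_coloring J (A \<union> B) c"
proof -
  interpret S: graph_join H G J g f by (rule swap)
  have AB: "c ` f ` pverts G = A" "c ` g ` pverts H = B"
    using assms by (auto simp: acyclic_coloring_def proper_coloring_def image_comp)
  have pc: "proper_coloring J (A \<union> B) c"
    using assms AB by (simp add: proper_coloring_join_iff acyclic_coloring_def)
  have inj: "inj_on c (color_class J c j)" if "j \<in> B" for j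
  proof -
    have "j \<notin> c ` f ` pverts G" using that assms(3) AB by blast
    then show ?thesis
      unfolding S.color_class_left[OF \<open>j \<notin> _\<close>] using assms(4)
      by (auto simp: color_class_def inj_on_def)
  qed
  have "undirected_forest (with_proj J \<restriction> (color_class J c i \<union> color_class J c j))"
    if ij: "i \<in> A \<union> B" "j \<in> A \<union> B" for i j
  proof (cases "i \<in> B \<or> j \<in> B")
    case True
    then show ?thesis
      using undirected_forest_singleton_class[OF pc] inj by (metis Un_commute)
  next
    case False
    then have "undirected_forest
        (with_proj G \<restriction> (color_class G (c \<circ> f) i \<union> color_class G (c \<circ> f) j))"
      using assms(1) ij by (simp add: acyclic_coloring_def)
    then show ?thesis
      using False AB by (simp add: color_class_left image_Un[symmetric] forest_image_iff)
  qed
  then show ?thesis using pc by (simp add: acyclic_coloring_def)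
qed

section \<open>Recoloring steps of a join\<close>

text \<open>A vertex of \<open>G\<close> sees every vertex of \<open>H\<close>, hence every color of
  \<open>H\<close>; this confines its recoloring to colors of \<open>G\<close>.\<close>

lemma closed_nbhd_left:
  assumes "x \<in> pverts G"
  shows "closed_nbhd J (f x) = f ` closed_nbhd G x \<union> g ` pverts H"
proof -
  have "b \<in> f ` {x'. (x, x') \<in> parcs G} \<union> g ` pverts H" if "(f x, b) \<in> parcs J" for b
    using that by (cases rule: arc_cases) (use inj_f f_neq_g in \<open>auto dest: injD\<close>)
  then show ?thesis using assms by (auto simp: closed_nbhd_def arc_ff arc_fg)
qed

text \<open>The free colors of a vertex of \<open>G\<close> are the same in \<open>G\<close> and in
  the join, and \<open>H\<close> is untouched because \<open>i\<close> does not occur on it.\<close>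

lemma recoloring_step_join_left:
  assumes "recoloring_step J C c i c'" "i \<in> c ` f ` pverts G"
  shows "recoloring_step G (c ` f ` pverts G) (c \<circ> f) i (c' \<circ> f)"
    and "\<And>y. y \<in> pverts H \<Longrightarrow> c' (g y) = c (g y)"
proof -
  have pc: "proper_coloring J C c"
    and new: "\<And>v. v \<in> pverts J \<Longrightarrow> c v = i \<Longrightarrow> c' v \<in> C - c ` closed_nbhd J v"
    and old: "\<And>v. v \<in> pverts J \<Longrightarrow> c v \<noteq> i \<Longrightarrow> c' v = c v"
    using assms(1) by (auto simp: recoloring_step_iff)
  note R = pc[unfolded proper_coloring_join_iff]
  have "(c' \<circ> f) x \<in> c ` f ` pverts G - (c \<circ> f) ` closed_nbhd G x"
    if x: "x \<in> pverts G" "(c \<circ> f) x = i" for x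
  proof -
    have "c' (f x) \<in> C - c ` closed_nbhd J (f x)" using new[of "f x"] x pverts_J by auto
    then show ?thesis using R by (auto simp: closed_nbhd_left[OF x(1)] image_Un image_comp)
  qed
  then show "recoloring_step G (c ` f ` pverts G) (c \<circ> f) i (c' \<circ> f)"
    using R assms(2) old pverts_J by (auto simp: recoloring_step_iff)
  show "c' (g y) = c (g y)" if "y \<in> pverts H" for y
    using old[of "g y"] that R assms(2) pverts_J by blast
qed

lemma acyclic_recoloring_step_join_left:
  assumes "acyclic_recoloring_step J C c i c'" "i \<in> c ` f ` pverts G"
  shows "acyclic_recoloring_step G (c ` f ` pverts G) (c \<circ> f) i (c' \<circ> f)"
proof -
  have st: "recoloring_step J C c i c'" "acyclic_coloring J C c" "acyclic_coloring J (C - {i}) c'"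
    using assms(1) by (auto simp: acyclic_recoloring_step_def)
  note rs = recoloring_step_join_left(1)[OF st(1) assms(2)]
  have "c' ` f ` pverts G = c ` f ` pverts G - {i}"
    using proper_coloring_recoloring_step[OF G.pair_graph_axioms rs]
    by (simp add: proper_coloring_def image_comp)
  then show ?thesis
    using rs acyclic_coloring_joinD_left[OF st(2)] acyclic_coloring_joinD_left[OF st(3)]
    by (simp add: acyclic_recoloring_step_def)
qed

text \<open>Removing a color of \<open>H\<close> repeats a color there, so the other side has to be injective.\<close>
lemma acyclic_recoloring_step_join_right_inj:
  assumes "acyclic_recoloring_step J C c i c'" "i \<in> c ` g ` pverts H"
  shows "inj_on (c \<circ> f) (pverts G)"
proof -
  interpret S: graph_join H G J g f by (rule swap)
  have st: "recoloring_step J C c i c'" "acyclic_coloring J (C - {i}) c'"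
    using assms(1) by (auto simp: acyclic_recoloring_step_def)
  have "(c' \<circ> g) ` pverts H = c ` g ` pverts H - {i}"
    using proper_coloring_recoloring_step[OF H.pair_graph_axioms
        S.recoloring_step_join_left(1)[OF st(1) assms(2)]]
    by (simp add: proper_coloring_def)
  \<comment> \<open>\<open>H\<close> has lost a color, so \<open>c'\<close> uses fewer colors on it
    than it has vertices.\<close>
  then have "card ((c' \<circ> g) ` pverts H) < card ((c \<circ> g) ` pverts H)"
    using card_Diff1_less[of "c ` g ` pverts H" i] assms(2) H.pair_finite_verts
    by (simp only: image_comp finite_imageI)
  also have "\<dots> \<le> card (pverts H)" using H.pair_finite_verts by (rule card_image_le)
  finally have "\<not> inj_on (c' \<circ> g) (pverts H)" using card_image[of "c' \<circ> g" "pverts H"] by auto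
  then have "inj_on (c' \<circ> f) (pverts G)" using acyclic_coloring_join_inj[OF st(2)] by blast
  \<comment> \<open>The step leaves the colors of \<open>G\<close> alone, so injectivity passes from
    \<open>c'\<close> to \<open>c\<close>.\<close>
  then show ?thesis
    using S.recoloring_step_join_left(2)[OF st(1) assms(2)] by (simp add: inj_on_def)
qed

section \<open>Unreducible colorings and the spectrum of a join\<close>

text \<open>A step of \<open>G\<close>, extended by \<open>c\<close> on \<open>H\<close>, would be a
  step of the join; injectivity on \<open>H\<close> keeps the extended coloring acyclic.\<close>

lemma acyclic_b_coloring_joinD_left:
  assumes "acyclic_b_coloring J C c" "inj_on (c \<circ> g) (pverts H)"
  shows "acyclic_b_coloring G (c ` f ` pverts G) (c \<circ> f)"
proof -
  interpret S: graph_join H G J g f by (rule swap)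
  let ?A = "c ` f ` pverts G" and ?B = "c ` g ` pverts H"
  have ac: "acyclic_coloring J C c" using assms(1) by (simp add: acyclic_b_coloring_def)
  then have pc: "proper_coloring J C c" by (simp add: acyclic_coloring_def)
  note R = pc[unfolded proper_coloring_join_iff]
  have "\<not> acyclic_recoloring_step G ?A (c \<circ> f) i d" for i d
  proof
    assume "acyclic_recoloring_step G ?A (c \<circ> f) i d"
    then have i: "i \<in> ?A" and acd: "acyclic_coloring G (?A - {i}) d"
      and new: "\<And>v. v \<in> pverts G \<Longrightarrow> c (f v) = i \<Longrightarrow> d v \<in> ?A - (c \<circ> f) ` closed_nbhd G v"
      and old: "\<And>v. v \<in> pverts G \<Longrightarrow> c (f v) \<noteq> i \<Longrightarrow> d v = c (f v)"
      by (auto simp: acyclic_recoloring_step_def recoloring_step_iff)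
    \<comment> \<open>\<open>d\<close> is transported along \<open>f\<close>, and all other values
      stay those of \<open>c\<close>; the two compositions below are then equalities of
      functions.\<close>
    define c' where "c' a = (if a \<in> range f then d (inv f a) else c a)" for a
    have c'f: "c' \<circ> f = d" and c'g: "c' \<circ> g = c \<circ> g"
      using inj_f f_neq_g[symmetric] by (auto simp: c'_def fun_eq_iff)
    have "acyclic_coloring J ((?A - {i}) \<union> ?B) c'"
      using acd S.acyclic_coloring_joinD_left[OF ac] R assms(2)
      by (intro acyclic_coloring_joinI) (auto simp: c'f c'g)
    moreover have "(?A - {i}) \<union> ?B = C - {i}" using R i by blast
    moreover have "recoloring_step J C c i c'"
      unfolding recoloring_step_iff
    proof (intro conjI ballI impI)
      show "i \<in> C" using R i by blast
      fix v assume v: "v \<in> pverts J"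
      show "c' v \<in> C - c ` closed_nbhd J v" if "c v = i"
      proof -
        have "v \<notin> g ` pverts H" using R i that by auto
        then obtain x where x: "v = f x" "x \<in> pverts G" using v pverts_J by auto
        have "c' v = d x" using x fun_cong[OF c'f, of x] by simp
        then show ?thesis
          using new[OF x(2)] that R x by (auto simp: closed_nbhd_left image_Un image_comp)
      qed
      show "c' v = c v" if "c v \<noteq> i"
      proof -
        consider x where "v = f x" "x \<in> pverts G" | y where "v = g y" using v pverts_J by auto
        then show ?thesis
          using that old fun_cong[OF c'f] fun_cong[OF c'g] by cases auto
      qed
    qed (rule pc)
    ultimately have "acyclic_recoloring_step J C c i c'"
      using ac by (simp add: acyclic_recoloring_step_def)
    then show False using assms(1) by (auto simp: acyclic_b_coloring_def)
  qed
  then show ?thesis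
    using acyclic_coloring_joinD_left[OF ac] by (simp add: acyclic_b_coloring_def)
qed

lemma acyclic_b_spectrum_joinD_left:
  assumes "acyclic_b_coloring J C c" "inj_on (c \<circ> g) (pverts H)"
  shows "\<exists>m \<in> acyclic_b_spectrum G. card C = m + card (pverts H)"
proof -
  let ?A = "c ` f ` pverts G" and ?B = "c ` g ` pverts H"
  have R: "C = ?A \<union> ?B" "?A \<inter> ?B = {}"
    using assms(1) by (auto simp: acyclic_b_coloring_def acyclic_coloring_def proper_coloring_join_iff)
  have "card C = card ?A + card ?B"
    using R G.pair_finite_verts H.pair_finite_verts by (simp add: card_Un_disjoint)
  moreover have "card ?B = card (pverts H)" using card_image[OF assms(2)] by (simp add: image_comp)
  moreover have "card ?A \<in> acyclic_b_spectrum G"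
    by (rule card_in_acyclic_b_spectrum[OF G.pair_graph_axioms acyclic_b_coloring_joinD_left[OF assms]])
  ultimately show ?thesis by auto
qed

text \<open>A step removing a color of \<open>G\<close> would restrict to a step of
  \<open>G\<close>. One removing a color of \<open>H\<close> needs \<open>c\<close> injective on
  \<open>G\<close>; by \<open>no_right\<close>, \<open>H\<close> is then complete and none of its
  colors is free.\<close>

lemma acyclic_b_coloring_joinI:
  assumes bG: "acyclic_b_coloring G A (c \<circ> f)" and inj: "inj_on (c \<circ> g) (pverts H)"
    and disj: "A \<inter> c ` g ` pverts H = {}"
    and no_right: "\<not> inj_on (c \<circ> f) (pverts G) \<or> complete_digraph q (with_proj H)"
  shows "acyclic_b_coloring J (A \<union> c ` g ` pverts H) c"
proof -
  interpret S: graph_join H G J g f by (rule swap)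
  let ?B = "c ` g ` pverts H"
  have acG: "acyclic_coloring G A (c \<circ> f)" using bG by (simp add: acyclic_b_coloring_def)
  then have A: "c ` f ` pverts G = A"
    by (auto simp: acyclic_coloring_def proper_coloring_def)
  have "proper_coloring H ?B (c \<circ> g)"
    using inj by (auto simp: proper_coloring_def inj_on_def dest: H.wellformed' H.no_loops')
  then have "acyclic_coloring H ?B (c \<circ> g)"
    by (rule acyclic_coloring_inj_except) (use inj in \<open>auto simp: inj_on_def\<close>)
  then have acJ: "acyclic_coloring J (A \<union> ?B) c" using acyclic_coloring_joinI acG disj inj by blast
  have "\<not> acyclic_recoloring_step J (A \<union> ?B) c i c'" for i c'
  proof
    assume st: "acyclic_recoloring_step J (A \<union> ?B) c i c'"
    then have rs: "recoloring_step J (A \<union> ?B) c i c'" by (simp add: acyclic_recoloring_step_def)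
    then have "i \<in> A \<or> i \<in> ?B" by (simp add: recoloring_step_iff)
    then show False
    proof
      assume "i \<in> A"
      then show False
        using acyclic_recoloring_step_join_left[OF st] A bG by (auto simp: acyclic_b_coloring_def)
    next
      assume i: "i \<in> ?B"
      then have "inj_on (c \<circ> f) (pverts G)" by (rule acyclic_recoloring_step_join_right_inj[OF st])
      then have H: "parcs H = {(u, v). (u, v) \<in> pverts H \<times> pverts H \<and> u \<noteq> v}"
        using no_right by (simp add: complete_digraph_pair_def)
      obtain y where y: "y \<in> pverts H" "c (g y) = i" using i by auto
      then have "(c' \<circ> g) y \<in> ?B - (c \<circ> g) ` closed_nbhd H y"
        using S.recoloring_step_join_left(1)[OF rs i] by (auto simp: recoloring_step_iff)
      \<comment> \<open>In a complete \<open>H\<close>, \<open>y\<close> sees all colors of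
        \<open>?B\<close>, so no replacement color remains.\<close>
      moreover have "closed_nbhd H y = pverts H" using y H by (auto simp: closed_nbhd_def)
      ultimately show False by (auto simp: image_comp)
    qed
  qed
  then show ?thesis using acJ by (simp add: acyclic_b_coloring_def)
qed

lemma acyclic_b_spectrum_joinI_left:
  assumes "m \<in> acyclic_b_spectrum G"
    and "\<not> complete_digraph (card (pverts G)) (with_proj G) \<or> complete_digraph q (with_proj H)"
  shows "m + card (pverts H) \<in> acyclic_b_spectrum J"
proof -
  let ?n = "card (pverts H)"
  obtain d where d: "acyclic_b_coloring G {1..m} d"
    using assms(1) by (auto simp: acyclic_b_spectrum_def acyclic_b_coloring_def)
  \<comment> \<open>The fresh colors start at \<open>m+1\<close>, so that together with
    \<open>{1..m}\<close> they form an initial segment.\<close>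
  obtain e where e: "bij_betw e (pverts H) {m+1..m+?n}"
    using finite_same_card_bij[OF H.pair_finite_verts, of "{m+1..m+?n}"] by auto
  define c where "c a = (if a \<in> range f then d (inv f a) else e (inv g a))" for a
  have cf: "c \<circ> f = d" and cg: "c \<circ> g = e"
    using inj_f inj_g f_neq_g[symmetric] by (auto simp: c_def fun_eq_iff)
  have B: "c ` g ` pverts H = {m+1..m+?n}"
    using e cg by (metis bij_betw_def image_comp)
  have "acyclic_b_coloring J ({1..m} \<union> c ` g ` pverts H) c"
  proof (rule acyclic_b_coloring_joinI)
    show "\<not> inj_on (c \<circ> f) (pverts G) \<or> complete_digraph q (with_proj H)"
      using assms(2) acyclic_b_coloring_not_inj[OF G.pair_graph_axioms _ d] cf by auto
  qed (use d e cf cg B in \<open>auto simp: bij_betw_def\<close>)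
  moreover have "{1..m} \<union> {m+1..m+?n} = {1..m+?n}" by auto
  ultimately have "acyclic_b_coloring J {1..m + ?n} c" using B by simp
  then show ?thesis by (auto simp: acyclic_b_spectrum_def acyclic_b_coloring_def)
qed

text \<open>By \<open>acyclic_coloring_join_inj\<close> each unreducible coloring is injective on
  one side and so contributes to the term of the other side; conversely,
  \<open>acyclic_b_spectrum_joinI_left\<close> applies to either order of the sides.\<close>

lemma acyclic_b_spectrum_join:
  assumes "\<not> complete_digraph (card (pverts G)) (with_proj G)"
    and "\<not> complete_digraph (card (pverts H)) (with_proj H)"
  shows "acyclic_b_spectrum J = (\<lambda>m. m + card (pverts H)) ` acyclic_b_spectrum G \<union>
    (\<lambda>m. m + card (pverts G)) ` acyclic_b_spectrum H"
proof (intro equalityI subsetI)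
  interpret S: graph_join H G J g f by (rule swap)
  fix k assume "k \<in> acyclic_b_spectrum J"
  then obtain c where c: "acyclic_b_coloring J {1..k} c"
    by (auto simp: acyclic_b_spectrum_def acyclic_b_coloring_def)
  then have "inj_on (c \<circ> f) (pverts G) \<or> inj_on (c \<circ> g) (pverts H)"
    using acyclic_coloring_join_inj by (auto simp: acyclic_b_coloring_def)
  then show "k \<in> (\<lambda>m. m + card (pverts H)) ` acyclic_b_spectrum G \<union>
    (\<lambda>m. m + card (pverts G)) ` acyclic_b_spectrum H"
    using acyclic_b_spectrum_joinD_left[OF c] S.acyclic_b_spectrum_joinD_left[OF c] by auto
next
  interpret S: graph_join H G J g f by (rule swap)
  fix k assume "k \<in> (\<lambda>m. m + card (pverts H)) ` acyclic_b_spectrum G \<union>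
    (\<lambda>m. m + card (pverts G)) ` acyclic_b_spectrum H"
  then show "k \<in> acyclic_b_spectrum J"
    using acyclic_b_spectrum_joinI_left S.acyclic_b_spectrum_joinI_left assms by blast
qed

text \<open>Every proper coloring of a complete \<open>H\<close> is injective, so only the term of
  \<open>G\<close> arises. For the converse, completeness of \<open>H\<close> is the second
  alternative in \<open>acyclic_b_spectrum_joinI_left\<close>.\<close>

lemma acyclic_b_spectrum_join_complete:
  assumes "complete_digraph q (with_proj H)"
  shows "acyclic_b_spectrum J = (\<lambda>m. m + q) ` acyclic_b_spectrum G"
proof (intro equalityI subsetI)
  have H: "parcs H = {(u, v). (u, v) \<in> pverts H \<times> pverts H \<and> u \<noteq> v}" "card (pverts H) = q"
    using assms by (auto simp: complete_digraph_pair_def)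
  {
    fix k assume "k \<in> acyclic_b_spectrum J"
    then obtain c where c: "acyclic_b_coloring J {1..k} c"
      by (auto simp: acyclic_b_spectrum_def acyclic_b_coloring_def)
    then have "proper_coloring H (c ` g ` pverts H) (c \<circ> g)"
      by (simp add: acyclic_b_coloring_def acyclic_coloring_def proper_coloring_join_iff)
    then have "inj_on (c \<circ> g) (pverts H)" using H(1) by (force simp: proper_coloring_def inj_on_def)
    then show "k \<in> (\<lambda>m. m + q) ` acyclic_b_spectrum G"
      using acyclic_b_spectrum_joinD_left[OF c] H(2) by auto
  next
    fix k assume "k \<in> (\<lambda>m. m + q) ` acyclic_b_spectrum G"
    then show "k \<in> acyclic_b_spectrum J"
      using acyclic_b_spectrum_joinI_left assms H(2) by blast
  }
qed

end

section \<open>From spectra to their maxima\<close>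

lemma graph_join_join_graph:
  assumes "pair_graph G" "pair_graph H"
  shows "graph_join G H (G \<or>\<^sub>G H) Inl Inr"
proof -
  interpret G: pair_graph G by fact
  interpret H: pair_graph H by fact
  interpret J: pair_graph "G \<or>\<^sub>G H" using assms by (rule pair_graph_join)
  show ?thesis by unfold_locales (auto simp: join_graph_def)
qed

lemma Max_shift_acyclic_b_spectrum:
  assumes "pair_graph G"
  shows "Max ((\<lambda>m. m + k) ` acyclic_b_spectrum G) = A\<^sub>b G + k"
proof -
  interpret pair_graph G by fact
  show ?thesis
    using Max_add_commute[of "acyclic_b_spectrum G" "\<lambda>m. m" k]
      finite_acyclic_b_spectrum[OF pair_finite_verts] acyclic_b_spectrum_nonempty[OF assms]
    by (simp add: acyclic_b_chromatic_def)
qed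

theorem theorem5:
  shows "(\<forall>(G :: 'a pair_pre_digraph) (H :: 'b pair_pre_digraph).
            pair_graph G \<longrightarrow> pair_graph H \<longrightarrow>
            \<not> complete_digraph (card (pverts G)) (with_proj G) \<longrightarrow>
            \<not> complete_digraph (card (pverts H)) (with_proj H) \<longrightarrow>
            A\<^sub>b (G \<or>\<^sub>G H) = max (A\<^sub>b G + card (pverts H)) (A\<^sub>b H + card (pverts G)))
       \<and> (\<forall>(G :: 'a pair_pre_digraph) (K :: 'b pair_pre_digraph) q.
            pair_graph G \<longrightarrow> 1 \<le> q \<longrightarrow> complete_digraph q (with_proj K) \<longrightarrow>
            A\<^sub>b (G \<or>\<^sub>G K) = A\<^sub>b G + q)"
proof (intro conjI allI impI)
  fix G :: "'a pair_pre_digraph" and H :: "'b pair_pre_digraph"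
  assume GH: "pair_graph G" "pair_graph H"
    and nc: "\<not> complete_digraph (card (pverts G)) (with_proj G)"
      "\<not> complete_digraph (card (pverts H)) (with_proj H)"
  interpret graph_join G H "G \<or>\<^sub>G H" Inl Inr using GH by (rule graph_join_join_graph)
  have "A\<^sub>b (G \<or>\<^sub>G H) = max (Max ((\<lambda>m. m + card (pverts H)) ` acyclic_b_spectrum G))
      (Max ((\<lambda>m. m + card (pverts G)) ` acyclic_b_spectrum H))"
    unfolding acyclic_b_chromatic_def acyclic_b_spectrum_join[OF nc]
    by (intro Max_Un finite_imageI finite_acyclic_b_spectrum G.pair_finite_verts
        H.pair_finite_verts) (use acyclic_b_spectrum_nonempty GH in auto)
  then show "A\<^sub>b (G \<or>\<^sub>G H) = max (A\<^sub>b G + card (pverts H)) (A\<^sub>b H + card (pverts G))"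
    using GH by (simp add: Max_shift_acyclic_b_spectrum)
next
  fix G :: "'a pair_pre_digraph" and K :: "'b pair_pre_digraph" and q :: nat
  assume G: "pair_graph G" and K: "complete_digraph q (with_proj K)"
  interpret graph_join G K "G \<or>\<^sub>G K" Inl Inr
    using G pair_graphI_complete[OF K] by (rule graph_join_join_graph)
  show "A\<^sub>b (G \<or>\<^sub>G K) = A\<^sub>b G + q"
    using Max_shift_acyclic_b_spectrum[OF G, of q] acyclic_b_spectrum_join_complete[OF K]
    by (simp add: acyclic_b_chromatic_def)
qed

end
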